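(* Let $n\ge1$, $\alpha$ a Dyck path of length $2n$ and $\beta$ a Dyck path of length $2n+2$. Let $\mathfrak{S}(\alpha,\beta)$ be the set of $w\in\mathfrak{S}_{2n}$ with $p_A(w)=\alpha$ and $p_B(w)=\beta$. Then \[\sum_{w\in\mathfrak{S}(\alpha,\beta)} q^{aa(w)}r^{bb(w)}=\prod_{i=1}^n [h_i(\alpha)]_q\,[h_i^*(\beta)]_r,\] where $q,r$ are formal variables and $[h]_q=1+q+\dots+q^{h-1}$.
   Context: A Dyck path of length $2N$ is a lattice path from $(0,0)$ to $(2N,0)$ with steps $(1,1)$ (up) and $(1,-1)$ (down) staying weakly above the $x$-axis; the down step ending at $x$-coordinate $k$ and going from height $h$ to $h-1$ is said to be at position $k$ with height $h$; the path is determined by its set of down-step positions. $h_i(p)$ is the height of the $i$th down step of $p$, and $h_i^*(p)=h_i(p)-1$ if there is no up step to the right of the $i$th down step, $h_i^*(p)=h_i(p)$ otherwise. Crossout procedure: for $w\in\mathfrak{S}_{2n}$ in one-line notation, repeat until all positions are marked: mark "B" at the unmarked position $i$ with smallest value $w(i)$, then mark "A" at the leftmost unmarked position. $\mathcal{A}(w)$, $\mathcal{B}(w)$ denote the sets of positions marked A and B. $p_A(w)$ is the Dyck path of length $2n$ with down-step positions $\{w(a):a\in\mathcal{A}(w)\}$; $p_B(w)$ is the Dyck path of length $2n+2$ with down-step positions $\{b+1:b\in\mathcal{B}(w)\}\cup\{2n+2\}$. For $X,Y\in\{A,B\}$, an XY inversion of $w$ is a pair of positions $i<j$ with $w(i)>w(j)$,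 $i$ marked X and $j$ marked Y. $aa(w)$ and $bb(w)$ denote the numbers of AA and BB inversions. *)

theory Defs
  imports
    "HOL-Library.While_Combinator"
    "HOL-Combinatorics.Permutations"
    "HOL-Computational_Algebra.Polynomial"
begin

datatype step = Up | Down

(* The k-th entry of a path (counting from 1) is its step from x-coordinate k - 1 to k. *)
type_synonym path = "step list"

definition step_at :: "path \<Rightarrow> nat \<Rightarrow> step" where
  "step_at p k = p ! (k - 1)"

definition height_at :: "path \<Rightarrow> nat \<Rightarrow> int" where
  "height_at p x = int (count_list (take x p) Up) - int (count_list (take x p) Down)"

definition dyck_path :: "nat \<Rightarrow> path \<Rightarrow> bool" where
  "dyck_path N p \<longleftrightarrow>
     length p = 2 * N \<and> (\<forall>x\<le>2 * N. 0 \<le> height_at p x) \<and> height_at p (2 * N) = 0"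

definition down_positions :: "path \<Rightarrow> nat set" where
  "down_positions p = {k \<in> {1..length p}. step_at p k = Down}"

definition down_pos :: "path \<Rightarrow> nat \<Rightarrow> nat" where
  "down_pos p i = sorted_list_of_set (down_positions p) ! (i - 1)"

(* The height of a down step is the height at its starting point; it is positive on a Dyck
   path, so the conversion to nat and the subtraction in down_height_star do not truncate. *)
definition down_height :: "path \<Rightarrow> nat \<Rightarrow> nat" where
  "down_height p i = nat (height_at p (down_pos p i - 1))"

definition down_height_star :: "path \<Rightarrow> nat \<Rightarrow> nat" where
  "down_height_star p i =
     (if \<exists>k\<in>{1..length p}. down_pos p i < k \<and> step_at p k = Up
      then down_height p i else down_height p i - 1)"

definition path_of_downs :: "nat \<Rightarrow> nat set \<Rightarrow> path" where
  "path_of_downs N D = map (\<lambda>k. if k \<in> D then Down else Up) [1..<2 * N + 1]"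

(* A state is the pair of the sets of positions marked A and marked B so far. *)
definition crossout_step ::
  "nat \<Rightarrow> (nat \<Rightarrow> nat) \<Rightarrow> nat set \<times> nat set \<Rightarrow> nat set \<times> nat set" where
  "crossout_step n w = (\<lambda>(A, B).
     let B' = insert (arg_min_on w ({1..2 * n} - (A \<union> B))) B;
         A' = insert (Min ({1..2 * n} - (A \<union> B'))) A
     in (A', B'))"

definition crossout :: "nat \<Rightarrow> (nat \<Rightarrow> nat) \<Rightarrow> nat set \<times> nat set" where
  "crossout n w = while (\<lambda>(A, B). A \<union> B \<noteq> {1..2 * n}) (crossout_step n w) ({}, {})"

definition A_marks :: "nat \<Rightarrow> (nat \<Rightarrow> nat) \<Rightarrow> nat set" where
  "A_marks n w = fst (crossout n w)"

definition B_marks :: "nat \<Rightarrow> (nat \<Rightarrow> nat) \<Rightarrow> nat set" where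
  "B_marks n w = snd (crossout n w)"

definition p_A :: "nat \<Rightarrow> (nat \<Rightarrow> nat) \<Rightarrow> path" where
  "p_A n w = path_of_downs n (w ` A_marks n w)"

definition p_B :: "nat \<Rightarrow> (nat \<Rightarrow> nat) \<Rightarrow> path" where
  "p_B n w = path_of_downs (n + 1) ((\<lambda>b. b + 1) ` B_marks n w \<union> {2 * n + 2})"

definition inversions_between :: "(nat \<Rightarrow> nat) \<Rightarrow> nat set \<Rightarrow> nat set \<Rightarrow> (nat \<times> nat) set" where
  "inversions_between w X Y = {(i, j). i \<in> X \<and> j \<in> Y \<and> i < j \<and> w i > w j}"

definition aa :: "nat \<Rightarrow> (nat \<Rightarrow> nat) \<Rightarrow> nat" where
  "aa n w = card (inversions_between w (A_marks n w) (A_marks n w))"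

definition bb :: "nat \<Rightarrow> (nat \<Rightarrow> nat) \<Rightarrow> nat" where
  "bb n w = card (inversions_between w (B_marks n w) (B_marks n w))"

definition perms_with_paths :: "nat \<Rightarrow> path \<Rightarrow> path \<Rightarrow> (nat \<Rightarrow> nat) set" where
  "perms_with_paths n \<alpha> \<beta> = {w. w permutes {1..2 * n} \<and> p_A n w = \<alpha> \<and> p_B n w = \<beta>}"

definition q_bracket :: "'a::comm_semiring_1 \<Rightarrow> nat \<Rightarrow> 'a" where
  "q_bracket x h = (\<Sum>k<h. x ^ k)"

(* The two indeterminates of the polynomial ring Z[q][r]. *)
definition var_q :: "int poly poly" where
  "var_q = [:[:0, 1:]:]"

definition var_r :: "int poly poly" where
  "var_r = [:0, 1:]"

end

theory Submission
  imports Defs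
begin

text \<open>
  List the A positions as \<open>a\<^sub>1 < \<dots> < a\<^sub>n\<close>, which is also the order in which they are marked, put
  \<open>u\<^sub>k = w(a\<^sub>k)\<close>, and let \<open>p\<^sub>k\<close> be the \<open>k\<close>-th marked B position, whose value is the \<open>k\<close>-th smallest
  B value \<open>v\<^sub>k\<close>. Given the sets of marks and values, the crossout procedure imposes exactly
  \<open>v\<^sub>k < u\<^sub>k\<close> and \<open>a\<^sub>k < p\<^sub>k\<^sub>+\<^sub>1\<close>; the AA inversions are the inversions of \<open>u\<close> and the BB inversions
  are those of \<open>p\<close>, so the sum is a product of two independent sums of the same kind.
  Each is evaluated by placing the entries in increasing order. The \<open>i\<close>-th smallest entry \<open>x\<close> may
  go to any free slot whose threshold is below \<open>x\<close>. These are the leftmost \<open>h\<close> free slots, where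
  \<open>h\<close> is the number of thresholds below \<open>x\<close> minus \<open>i - 1\<close>, and the \<open>j\<close>-th of them creates \<open>j - 1\<close>
  inversions. For \<open>u\<close>, \<open>h\<close> is a height of \<open>\<alpha>\<close>; for \<open>p\<close> the threshold \<open>a\<^sub>n\<close> is missing, which turns
  the heights of \<open>\<beta>\<close> into starred ones.
\<close>

section \<open>Inversions of lists\<close>

primrec list_inv :: "nat list \<Rightarrow> nat" where
  "list_inv [] = 0"
| "list_inv (x # xs) = length (filter (\<lambda>y. y < x) xs) + list_inv xs"

text \<open>A strict minimum exceeds nothing to its right and is exceeded by everything to its left,
  so only the latter pairs are new.\<close>

lemma list_inv_insert_min:
  assumes "\<forall>y\<in>set xs \<union> set ys. x < y"
  shows "list_inv (xs @ x # ys) = length xs + list_inv (xs @ ys)"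
proof -
  have "filter (\<lambda>y. y < x) ys = []"
    using assms by (auto simp: filter_empty_conv not_less intro: less_imp_le)
  then show ?thesis
    using assms by (induction xs) auto
qed

text \<open>The head \<open>x\<close> has the smallest \<open>f\<close>-value, so it comes first in
  every pair that contains it. Two functions let one lemma serve both statistics:
  \<open>f = id\<close>, \<open>g = w\<close> for AA inversions and \<open>f = w\<close>,
  \<open>g = id\<close> for BB inversions.\<close>

lemma card_discordant_pairs:
  fixes f g :: "nat \<Rightarrow> nat"
  assumes "sorted_wrt (<) (map f xs)"
  shows "card {(i, j). i \<in> set xs \<and> j \<in> set xs \<and> f i < f j \<and> g j < g i} = list_inv (map g xs)"
    (is "card (?D xs) = _")
  using assms
proof (induction xs)
  case (Cons x xs)
  let ?E = "Pair x ` set (filter (\<lambda>y. g y < g x) xs)"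
  have first: "f x < f y" "\<not> f y < f x" if "y \<in> set xs" for y
    using Cons.prems that by (auto simp: not_less intro: less_imp_le)
  then have split: "?D (x # xs) = ?E \<union> ?D xs"
    by auto
  have dist: "distinct xs" "x \<notin> set xs"
    using Cons.prems distinct_map[of f "x # xs"] strict_sorted_iff[of "map f (x # xs)"] by auto
  have "finite (?D xs)"
    by (rule finite_subset[of _ "set xs \<times> set xs"]) auto
  moreover have "?E \<inter> ?D xs = {}"
    using dist by auto
  ultimately have "card (?D (x # xs)) = card ?E + card (?D xs)"
    unfolding split by (intro card_Un_disjoint) auto
  also have "card ?E = length (filter (\<lambda>y. g y < g x) xs)"
    using dist by (subst card_image) (auto simp: inj_on_def simp del: set_filter intro!: distinct_card)
  also have "\<dots> = length (filter (\<lambda>y. y < g x) (map g xs))"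
    by (simp add: filter_map comp_def)
  finally show ?case
    using Cons by simp
qed simp

section \<open>Arrangements above thresholds and their inversion generating function\<close>

text \<open>This common form covers both factors: the thresholds are the sorted B values for the A
  values, and 0 followed by all A positions but the last for the B positions.\<close>

definition arrangements_above :: "nat list \<Rightarrow> nat list \<Rightarrow> nat list set" where
  "arrangements_above ts xs = {us. mset us = mset xs \<and> list_all2 (<) ts us}"

lemma finite_arrangements_above: "finite (arrangements_above ts xs)"
  by (rule finite_subset[of _ "{us. mset us = mset xs}"])
     (auto simp: arrangements_above_def mset_eq_finite)

text \<open>In a sorted list the entries below \<open>x\<close> form an initial segment. Hence the
  slots open to an entry are the leftmost ones.\<close>

lemma length_filter_less_sorted:
  assumes "sorted ts" "j < length ts"
  shows "ts ! j < (x::nat) \<longleftrightarrow> j < length (filter (\<lambda>t. t < x) ts)"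
  using assms
proof (induction ts arbitrary: j)
  case (Cons t ts)
  show ?case
  proof (cases "t < x")
    case True
    with Cons show ?thesis by (cases j) auto
  next
    case False
    then have "filter (\<lambda>t. t < x) (t # ts) = []"
      using Cons.prems by (fastforce simp: filter_empty_conv)
    moreover have "\<not> (t # ts) ! j < x"
      using False Cons.prems by (cases j) (auto simp: not_less intro: order_trans)
    ultimately show ?thesis by simp
  qed
qed simp

text \<open>Induction with \<open>ts\<close> arbitrary: removing the minimum and its slot leaves a
  problem of the same shape. Truncated subtraction gives the right value: if too few thresholds lie
  below an entry, the bracket is \<open>q_bracket q 0 = 0\<close> and no arrangement exists.\<close>

lemma sum_arrangements_above:
  fixes q :: "'a::comm_semiring_1"
  assumes "sorted ts" "sorted_wrt (<) xs" "length ts = length xs"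
  shows "(\<Sum>us\<in>arrangements_above ts xs. q ^ list_inv us) =
         (\<Prod>i<length xs. q_bracket q (length (filter (\<lambda>t. t < xs ! i) ts) - i))"
  using assms
proof (induction xs arbitrary: ts)
  case Nil
  then show ?case by (simp add: arrangements_above_def)
next
  case (Cons x xs)
  define m where "m = length (filter (\<lambda>t. t < x) ts)"
  define del where "del j = take j ts @ drop (Suc j) ts" for j
  have len: "length ts = Suc (length xs)"
    using Cons.prems by simp
  have m_le: "m \<le> length ts"
    by (simp add: m_def)
  have ts_split: "ts = take j ts @ ts ! j # drop (Suc j) ts" if "j < m" for j
    using that m_le by (simp add: id_take_nth_drop)
  have small: "ts ! j < x \<longleftrightarrow> j < m" if "j < length ts" for j
    unfolding m_def using Cons.prems that by (intro length_filter_less_sorted)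
  have x_min: "\<forall>y\<in>set us. x < y" if "mset us = mset xs" for us
    using that Cons.prems by (metis mset_eq_setD sorted_wrt.simps(2))
  \<comment> \<open>The right-hand side is free of \<open>j\<close>, so the sum over
    \<open>j\<close> can later be split off as \<open>q_bracket q m\<close>.\<close>
  have IH: "(\<Sum>us\<in>arrangements_above (del j) xs. q ^ list_inv us) =
      (\<Prod>i<length xs. q_bracket q (length (filter (\<lambda>t. t < (x # xs) ! Suc i) ts) - Suc i))"
    if "j < m" for j
  proof -
    have "sorted (del j)"
      using Cons.prems(1) ts_split[OF that] unfolding del_def
      by (metis sorted_append sorted_wrt.simps(2) list.set_intros(2))
    moreover have "length (del j) = length xs"
      using that m_le len by (simp add: del_def)
    moreover have "length (filter (\<lambda>t. t < xs ! i) ts) =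
        Suc (length (filter (\<lambda>t. t < xs ! i) (del j)))" if "i < length xs" for i
    proof -
      \<comment> \<open>The deleted threshold lies below \<open>x\<close>, hence below every
        remaining entry. Each count drops by exactly one, which turns the offset \<open>i\<close>
        into \<open>Suc i\<close>.\<close>
      have "ts ! j < xs ! i"
        using small[of j] \<open>j < m\<close> m_le Cons.prems(2) that by (auto intro: less_trans)
      then show ?thesis
        by (subst ts_split[OF \<open>j < m\<close>]) (simp add: del_def)
    qed
    ultimately show ?thesis
      using Cons.IH[of "del j"] Cons.prems(2) by (auto intro!: prod.cong)
  qed
  \<comment> \<open>The minimum \<open>x\<close> sits at an index \<open>j < m\<close>, where it accounts for \<open>j\<close> inversions.\<close>
  have "(\<Sum>us\<in>arrangements_above ts (x # xs). q ^ list_inv us) =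
      (\<Sum>(j, us)\<in>Sigma {..<m} (\<lambda>j. arrangements_above (del j) xs). q ^ (j + list_inv us))"
  proof (rule sum.reindex_bij_witness[where
        j = "\<lambda>us. (length (takeWhile (\<lambda>y. y \<noteq> x) us), remove1 x us)" and
        i = "\<lambda>(j, us). take j us @ x # drop j us"])
    fix us assume "us \<in> arrangements_above ts (x # xs)"
    then have us: "mset us = mset (x # xs)" "list_all2 (<) ts us"
      by (auto simp: arrangements_above_def)
    then have "x \<in> set us"
      by (metis list.set_intros(1) mset_eq_setD)
    then obtain ys zs where yz: "us = ys @ x # zs" "x \<notin> set ys"
      by (meson split_list_first)
    have tw: "takeWhile (\<lambda>y. y \<noteq> x) us = ys" "remove1 x us = ys @ zs"
      using yz by (auto simp: remove1_append takeWhile_tail takeWhile_append)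
    show "(\<lambda>(j, us). take j us @ x # drop j us)
        (length (takeWhile (\<lambda>y. y \<noteq> x) us), remove1 x us) = us"
      using tw yz by simp
    have ms: "mset (ys @ zs) = mset xs"
      using us yz by simp
    have lt: "length ys < length ts"
      using us yz by (simp add: list_all2_lengthD)
    then have "ts ! length ys < x"
      using us(2) yz by (metis list_all2_nthD nth_append_length)
    then have ys_m: "length ys < m"
      using small lt by simp
    have "list_all2 (<) (take (length ys) ts @ ts ! length ys # drop (Suc (length ys)) ts) us"
      using us(2) ts_split[OF ys_m] by simp
    then have "list_all2 (<) (del (length ys)) (ys @ zs)"
      unfolding del_def yz using lt by (subst (asm) list_all2_append) (auto intro: list_all2_appendI)
    then show "(length (takeWhile (\<lambda>y. y \<noteq> x) us), remove1 x us)
        \<in> Sigma {..<m} (\<lambda>j. arrangements_above (del j) xs)"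
      using tw ms ys_m by (simp add: arrangements_above_def)
    show "(case (length (takeWhile (\<lambda>y. y \<noteq> x) us), remove1 x us) of
        (j, us) \<Rightarrow> q ^ (j + list_inv us)) = q ^ list_inv us"
      using tw yz list_inv_insert_min[of ys zs x] x_min[OF ms] by auto
  next
    fix z assume "z \<in> Sigma {..<m} (\<lambda>j. arrangements_above (del j) xs)"
    then obtain j us where z: "z = (j, us)" "j < m" "mset us = mset xs" "list_all2 (<) (del j) us"
      by (auto simp: arrangements_above_def)
    have x_notin: "x \<notin> set us"
      using x_min z by auto
    have "length us = length xs"
      using z(3) by (metis size_mset)
    then have j_le: "j \<le> length us"
      using z(2) m_le len by linarith
    have "takeWhile (\<lambda>y. y \<noteq> x) (take j us @ x # drop j us) = take j us"
      using x_notin by (subst takeWhile_append2) (auto dest: in_set_takeD)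
    moreover have "remove1 x (take j us @ x # drop j us) = us"
      using x_notin by (auto simp: remove1_append dest: in_set_takeD)
    ultimately show "(\<lambda>us. (length (takeWhile (\<lambda>y. y \<noteq> x) us), remove1 x us))
        ((\<lambda>(j, us). take j us @ x # drop j us) z) = z"
      using z j_le by simp
    have "mset (take j us @ x # drop j us) = mset (x # xs)"
      using z(3) by (metis append_take_drop_id mset.simps(2) mset_append union_mset_add_mset_right)
    moreover have "list_all2 (<) (take j ts @ ts ! j # drop (Suc j) ts) (take j us @ x # drop j us)"
    proof -
      have lj: "length (take j ts) = length (take j us)"
        using j_le z(2) m_le by simp
      have "list_all2 (<) (take j ts @ drop (Suc j) ts) (take j us @ drop j us)"
        using z(4) by (simp add: del_def)
      then have "list_all2 (<) (take j ts) (take j us)" "list_all2 (<) (drop (Suc j) ts) (drop j us)"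
        using list_all2_append[OF lj] by blast+
      then show ?thesis
        using small[of j] z(2) m_le by (auto intro!: list_all2_appendI)
    qed
    ultimately show "(\<lambda>(j, us). take j us @ x # drop j us) z \<in> arrangements_above ts (x # xs)"
      using z ts_split[OF z(2)] by (simp add: arrangements_above_def)
  qed
  also have "\<dots> = (\<Sum>j<m. q ^ j * (\<Sum>us\<in>arrangements_above (del j) xs. q ^ list_inv us))"
    by (subst sum.Sigma[symmetric]) (auto simp: finite_arrangements_above sum_distrib_left power_add)
  also have "\<dots> = q_bracket q m *
      (\<Prod>i<length xs. q_bracket q (length (filter (\<lambda>t. t < (x # xs) ! Suc i) ts) - Suc i))"
    by (simp add: IH q_bracket_def sum_distrib_right)
  also have "\<dots> = (\<Prod>i<length (x # xs). q_bracket q (length (filter (\<lambda>t. t < (x # xs) ! i) ts) - i))"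
    by (simp only: list.size(4) add_0 add_Suc_right add_0_right prod.lessThan_Suc_shift) (simp add: m_def)
  finally show ?case .
qed

section \<open>The crossout procedure as a condition on two lists\<close>

text \<open>The lists \<open>as\<close> and \<open>ps\<close> are the A and B positions in the order of marking.\<close>

fun crossout_order :: "(nat \<Rightarrow> nat) \<Rightarrow> nat list \<Rightarrow> nat list \<Rightarrow> bool" where
  "crossout_order w [] [] \<longleftrightarrow> True"
| "crossout_order w (a # as) (p # ps) \<longleftrightarrow>
     (\<forall>x\<in>insert a (set as \<union> set ps). w p < w x) \<and> (\<forall>x\<in>set as \<union> set ps. a < x) \<and>
     crossout_order w as ps"
| "crossout_order w _ _ \<longleftrightarrow> False"

text \<open>The loop is unfolded once per entry of the lists, so it ends when they do. The sets
  \<open>A\<close> and \<open>B\<close> are arbitrary because they collect the marks that the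
  induction has removed from the lists.\<close>

lemma while_crossout:
  assumes "crossout_order w as ps"
    and "{1..2 * n} = A \<union> B \<union> (set as \<union> set ps)"
    and "(A \<union> B) \<inter> (set as \<union> set ps) = {}"
  shows "while (\<lambda>(A, B). A \<union> B \<noteq> {1..2 * n}) (crossout_step n w) (A, B) = (A \<union> set as, B \<union> set ps)"
  using assms
proof (induction w as ps arbitrary: A B rule: crossout_order.induct)
  case (1 w)
  then show ?case by (subst while_unfold) simp
next
  case (2 w a as p ps)
  let ?R = "insert p (insert a (set as \<union> set ps))"
  have R: "{1..2 * n} - (A \<union> B) = ?R"
    using "2.prems" by auto
  have p_less: "w p < w x" if "x \<in> insert a (set as \<union> set ps)" for x
    using "2.prems"(1) that by auto
  then have p_notin: "p \<notin> insert a (set as \<union> set ps)"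
    by blast
  have a_less: "a < x" if "x \<in> set as \<union> set ps" for x
    using "2.prems"(1) that by auto
  \<comment> \<open>Strict minimality makes the minimiser unique, so the choice inside
    \<open>arg_min_on\<close> can only be \<open>p\<close>.\<close>
  have argmin: "arg_min_on w ?R = p"
    using arg_min_if_finite[of ?R w] p_less by blast
  have "{1..2 * n} - (A \<union> insert p B) = insert a (set as \<union> set ps)"
    using R p_notin by blast
  moreover have "Min (insert a (set as \<union> set ps)) = a"
    using a_less by (intro Min_eqI) (auto intro: less_imp_le)
  ultimately have step: "crossout_step n w (A, B) = (insert a A, insert p B)"
    unfolding crossout_step_def Let_def prod.case R argmin by simp
  have "A \<union> B \<noteq> {1..2 * n}"
    using "2.prems" by auto
  then have "while (\<lambda>(A, B). A \<union> B \<noteq> {1..2 * n}) (crossout_step n w) (A, B) =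
      while (\<lambda>(A, B). A \<union> B \<noteq> {1..2 * n}) (crossout_step n w) (insert a A, insert p B)"
    by (subst while_unfold) (simp add: step)
  also have "\<dots> = (insert a A \<union> set as, insert p B \<union> set ps)"
  proof (rule "2.IH")
    show "crossout_order w as ps" using "2.prems"(1) by simp
    show "{1..2 * n} = insert a A \<union> insert p B \<union> (set as \<union> set ps)"
      using "2.prems" by auto
    show "(insert a A \<union> insert p B) \<inter> (set as \<union> set ps) = {}"
      using "2.prems"(3) p_notin a_less by auto
  qed
  finally show ?case by simp
qed auto

lemma crossout_eq:
  assumes "crossout_order w as ps" "set as \<union> set ps = {1..2 * n}"
  shows "A_marks n w = set as" "B_marks n w = set ps"
  using while_crossout[of w as ps n "{}" "{}"] assms
  by (simp_all add: A_marks_def B_marks_def crossout_def)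

text \<open>The lists come from running the procedure on \<open>R\<close>: take the position of
  least value, then the leftmost of the rest. Injectivity makes the least value strictly
  least.\<close>

lemma crossout_order_exists:
  assumes "card R = 2 * m" "inj_on w R" "finite R"
  shows "\<exists>as ps. crossout_order w as ps \<and> set as \<union> set ps = R \<and> length as = m \<and> length ps = m"
  using assms
proof (induction m arbitrary: R)
  case 0
  then show ?case by (intro exI[of _ "[]"]) simp
next
  case (Suc m)
  have "R \<noteq> {}" using Suc by auto
  define p where "p = arg_min_on w R"
  have p: "p \<in> R" "\<And>x. x \<in> R \<Longrightarrow> w p \<le> w x"
    using arg_min_if_finite[OF Suc.prems(3) \<open>R \<noteq> {}\<close>, of w] by (auto simp: p_def not_less[symmetric])
  have p_less: "w p < w x" if "x \<in> R - {p}" for x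
    using p that Suc.prems(2) by (metis DiffE insertCI inj_onD le_neq_implies_less)
  have c1: "card (R - {p}) = Suc (2 * m)"
    using Suc p by simp
  then have "R - {p} \<noteq> {}"
    by (metis card.empty nat.distinct(1))
  define a where "a = Min (R - {p})"
  have a: "a \<in> R - {p}" "\<And>x. x \<in> R - {p} \<Longrightarrow> a \<le> x"
    using Suc.prems(3) \<open>R - {p} \<noteq> {}\<close> unfolding a_def by (intro Min_in Min_le; simp)+
  have "card (R - {p} - {a}) = 2 * m"
    using c1 a by simp
  moreover have "inj_on w (R - {p} - {a})"
    using Suc.prems(2) by (rule inj_on_subset) auto
  ultimately obtain as ps where rest: "crossout_order w as ps" "set as \<union> set ps = R - {p} - {a}"
      "length as = m" "length ps = m"
    using Suc.IH[of "R - {p} - {a}"] Suc.prems(3) by auto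
  have "a < x" if "x \<in> R - {p} - {a}" for x
    using a(2)[of x] that by force
  then have "crossout_order w (a # as) (p # ps)"
    using rest p_less a by simp
  moreover have "set (a # as) \<union> set (p # ps) = R"
    using rest(2) p a by auto
  ultimately show ?case
    using rest by (metis length_Cons)
qed

lemma list_all2_less_lower_bound:
  assumes "list_all2 (<) ys xs" "\<forall>y\<in>set ys. c < (y::nat)"
  shows "\<forall>x\<in>set xs. c < x"
  using assms by (induction rule: list_all2_induct) auto

text \<open>Comparisons with all later marks reduce to single ones by transitivity:
  \<open>w p\<close> is below the later B values, hence below the A values paired with them;
  \<open>a\<close> is left of the later A positions, hence of the B positions marked one round after
  those. \<open>butlast\<close> and \<open>tl\<close> express this shift by one round.\<close>

lemma crossout_order_iff:
  "crossout_order w as ps \<longleftrightarrow>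
     sorted_wrt (<) as \<and> sorted_wrt (<) (map w ps) \<and>
     list_all2 (<) (map w ps) (map w as) \<and> list_all2 (<) (butlast as) (tl ps)"
proof (induction w as ps rule: crossout_order.induct)
  case (2 w a as p ps)
  show ?case (is "?L \<longleftrightarrow> ?R")
  proof
    assume L: ?L
    then have IH: "sorted_wrt (<) as" "sorted_wrt (<) (map w ps)"
        "list_all2 (<) (map w ps) (map w as)" "list_all2 (<) (butlast as) (tl ps)"
      using 2 by auto
    \<comment> \<open>Prepending \<open>a\<close> pairs it with the head of \<open>ps\<close>, the B
      position marked in the next round; the old pairs stay as they were.\<close>
    have "list_all2 (<) (butlast (a # as)) ps"
    proof (cases ps)
      case Nil
      then show ?thesis using IH(3) by simp
    next
      case (Cons p' ps')
      then have "as \<noteq> []" using IH(3) by auto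
      then show ?thesis using Cons IH(4) L by simp
    qed
    then show ?R using L IH by simp
  next
    assume R: ?R
    have IH: "crossout_order w as ps"
      unfolding 2
    proof (intro conjI)
      show "list_all2 (<) (butlast as) (tl ps)"
        using R by (cases ps; cases as) auto
    qed (use R in auto)
    have "list_all2 (<) (map w ps) (map w as)" "\<forall>y\<in>set (map w ps). w p < y"
      using R by simp_all
    then have "\<forall>x\<in>set (map w as). w p < x"
      by (rule list_all2_less_lower_bound)
    moreover have "\<forall>x\<in>set ps. a < x"
    proof (cases as)
      case Nil
      then show ?thesis using R by simp
    next
      case (Cons a' as')
      with R obtain p' ps' where ps: "ps = p' # ps'" by (cases ps) auto
      have "\<forall>x\<in>set ps'. a < x"
      proof (rule list_all2_less_lower_bound)
        show "list_all2 (<) (butlast as) ps'"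
          using R ps Cons by simp
        show "\<forall>y\<in>set (butlast as). a < y"
          using R by (auto dest: in_set_butlastD)
      qed
      then show ?thesis using R ps Cons by simp
    qed
    ultimately show ?L using R IH by auto
  qed
qed auto

section \<open>Permutations given by lists of positions and values\<close>

text \<open>The default is \<open>x\<close> itself because \<open>permutes\<close> requires all
  points outside the set to be fixed.\<close>

definition relabel :: "nat list \<Rightarrow> nat list \<Rightarrow> nat \<Rightarrow> nat" where
  "relabel xs ys x = (case map_of (zip xs ys) x of None \<Rightarrow> x | Some y \<Rightarrow> y)"

lemma map_relabel:
  assumes "distinct xs" "length xs = length ys"
  shows "map (relabel xs ys) xs = ys"
  using assms by (intro nth_equalityI) (auto simp: relabel_def map_of_zip_nth)

lemma relabel_notin:
  assumes "length xs = length ys" "x \<notin> set xs"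
  shows "relabel xs ys x = x"
proof -
  have "map_of (zip xs ys) x = None"
    using assms by (simp add: map_of_zip_is_None)
  then show ?thesis by (simp add: relabel_def)
qed

lemma relabel_permutes:
  assumes "distinct xs" "distinct ys" "set ys = set xs"
  shows "relabel xs ys permutes set xs"
proof -
  have len: "length xs = length ys"
    using assms by (metis distinct_card)
  have m: "map (relabel xs ys) xs = ys"
    using assms len by (intro map_relabel)
  then have "inj_on (relabel xs ys) (set xs)"
    using assms distinct_map by metis
  moreover have "relabel xs ys ` set xs = set xs"
    using m assms(3) by (metis set_map)
  ultimately show ?thesis
    by (intro bij_imp_permutes) (auto simp: bij_betw_def relabel_notin len)
qed

section \<open>Factorization of the sum over permutations\<close>

lemma strict_sorted_list_unique:
  assumes "sorted_wrt (<) (xs::nat list)"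
  shows "xs = sorted_list_of_set (set xs)"
  using assms by (metis sorted_list_of_set.idem_if_sorted_distinct strict_sorted_iff)

lemma aa_eq_list_inv:
  assumes "sorted_wrt (<) as" "A_marks n w = set as"
  shows "aa n w = list_inv (map w as)"
  using card_discordant_pairs[of id as w] assms
  by (simp add: aa_def inversions_between_def)

text \<open>Along increasing B values an inversion is a drop in position. Positions and values
  exchange roles, hence the \<open>prod.swap\<close>.\<close>

lemma bb_eq_list_inv:
  assumes "sorted_wrt (<) (map w ps)" "B_marks n w = set ps"
  shows "bb n w = list_inv ps"
proof -
  have "inversions_between w (set ps) (set ps) =
      prod.swap ` {(i, j). i \<in> set ps \<and> j \<in> set ps \<and> w i < w j \<and> id j < id i}"
    by (auto simp: inversions_between_def image_iff)
  then have "bb n w = card {(i, j). i \<in> set ps \<and> j \<in> set ps \<and> w i < w j \<and> id j < id i}"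
    using assms(2) by (simp add: bb_def card_image)
  then show ?thesis
    using card_discordant_pairs[OF assms(1), of id] by simp
qed

text \<open>With marks and A values fixed, \<open>w\<close> amounts to a pair: the A values read
  along \<open>as\<close> and the B positions read along \<open>vs\<close>. By
  \<open>crossout_order_iff\<close> only \<open>vs\<close> constrains the first and only
  \<open>as\<close> the second, and each statistic depends on one component.\<close>

lemma sum_crossout_factorizes:
  fixes q r :: "'a::comm_semiring_1"
  assumes n: "n \<ge> 1"
    and AB: "A \<union> B = {1..2 * n}" "A \<inter> B = {}" "card A = n" "card B = n"
    and UV: "U \<union> V = {1..2 * n}" "U \<inter> V = {}" "card U = n" "card V = n"
  defines "as \<equiv> sorted_list_of_set A" and "vs \<equiv> sorted_list_of_set V"
  shows "(\<Sum>w | w permutes {1..2 * n} \<and> A_marks n w = A \<and> B_marks n w = B \<and> w ` A = U.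
            q ^ aa n w * r ^ bb n w) =
         (\<Sum>us\<in>arrangements_above vs (sorted_list_of_set U). q ^ list_inv us) *
         (\<Sum>ps\<in>arrangements_above (0 # butlast as) (sorted_list_of_set B). r ^ list_inv ps)"
    (is "sum _ ?W = sum _ ?S * sum _ ?T")
proof -
  have fin: "finite A" "finite B" "finite U" "finite V"
    using AB(1) UV(1) by (metis finite_Un finite_atLeastAtMost)+
  have as: "set as = A" "sorted_wrt (<) as" "length as = n" "distinct as"
    and vs: "set vs = V" "sorted_wrt (<) vs" "length vs = n" "distinct vs"
    using fin AB UV by (auto simp: as_def vs_def)
  have mset_iff: "mset us = mset (sorted_list_of_set X) \<longleftrightarrow> distinct us \<and> set us = X"
    if "finite X" for us and X :: "nat set"
    using that by (metis distinct_sorted_list_of_set mset_eq_imp_distinct_iff mset_eq_setD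
        set_eq_iff_mset_eq_distinct set_sorted_list_of_set)
  have S: "?S = {us. distinct us \<and> set us = U \<and> list_all2 (<) vs us}"
    and T: "?T = {ps. distinct ps \<and> set ps = B \<and> list_all2 (<) (0 # butlast as) ps}"
    using mset_iff fin by (auto simp: arrangements_above_def)
  \<comment> \<open>A run on \<open>w\<close> exists and its lists are forced: A positions and B
    values increase, so their sets determine them.\<close>
  have char: "w ` A = U \<and> distinct (map (inv w) vs) \<and> set (map (inv w) vs) = B \<and>
      crossout_order w as (map (inv w) vs)" if w: "w \<in> ?W" for w
  proof -
    have wp: "w permutes {1..2 * n}" and marks: "A_marks n w = A" "B_marks n w = B" "w ` A = U"
      using w by auto
    have injw: "inj w" and surjw: "surj w"
      using permutes_inj[OF wp] permutes_surj[OF wp] by simp_all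
    obtain as' ps where o: "crossout_order w as' ps" "set as' \<union> set ps = {1..2 * n}"
      using crossout_order_exists[of "{1..2 * n}" n w] injw by (auto intro: inj_on_subset)
    have sets: "set as' = A" "set ps = B"
      using crossout_eq[OF o] marks by auto
    have "as' = as"
      using strict_sorted_list_unique[of as'] o(1) sets by (simp add: crossout_order_iff as_def)
    have "w ` (A \<union> B) = U \<union> V"
      using wp AB UV by (simp add: permutes_image)
    moreover have "w ` A \<inter> w ` B = {}"
      using injw AB(2) by (metis image_Int image_empty)
    ultimately have "w ` B = V"
      using marks(3) UV(2) by blast
    then have "map w ps = vs"
      using strict_sorted_list_unique[of "map w ps"] o(1) sets by (simp add: crossout_order_iff vs_def)
    then have "map (inv w) vs = ps"
      using injw by (auto simp: map_idI)
    moreover have "distinct (map (inv w) vs)"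
      using vs(4) surjw by (simp add: distinct_map inj_on_def surj_imp_inj_inv) (metis surj_f_inv_f)
    ultimately show ?thesis
      using o(1) \<open>as' = as\<close> sets marks by auto
  qed
  have pos: "0 < x" if "x \<in> A \<union> B" for x
    using that AB(1) by auto
  \<comment> \<open>Positions start at 1, so every position exceeds the threshold 0. It stands for
    the unconstrained first B mark and restores the length lost in \<open>butlast\<close>.\<close>
  have T_iff: "list_all2 (<) (0 # butlast as) ps \<longleftrightarrow> list_all2 (<) (butlast as) (tl ps)"
    if "length ps = n" "set ps = B" for ps
    using that n pos by (cases ps) auto
  have "sum (\<lambda>w. q ^ aa n w * r ^ bb n w) ?W =
      (\<Sum>(us, ps)\<in>?S \<times> ?T. q ^ list_inv us * r ^ list_inv ps)"
  \<comment> \<open>A permutation is read off as A values in order of position and B positions in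
    order of value; matching \<open>as @ ps\<close> with \<open>us @ vs\<close> rebuilds it.\<close>
  proof (rule sum.reindex_bij_witness[where
        j = "\<lambda>w. (map w as, map (inv w) vs)" and
        i = "\<lambda>(us, ps). relabel (as @ ps) (us @ vs)"])
    fix w assume w: "w \<in> ?W"
    define ps where "ps = map (inv w) vs"
    note c = char[OF w, folded ps_def]
    have wp: "w permutes {1..2 * n}"
      using w by auto
    then have injw: "inj w" and surjw: "surj w"
      using permutes_inj[OF wp] permutes_surj[OF wp] by simp_all
    have wps: "map w ps = vs"
      using surjw by (simp add: ps_def comp_def surj_f_inv_f)
    have dist: "distinct (as @ ps)" "set (as @ ps) = {1..2 * n}"
      using as c AB by auto
    have "relabel (as @ ps) (map w as @ vs) = w"
    proof
      fix x
      have len: "length (as @ ps) = length (map w as @ vs)"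
        by (simp add: ps_def)
      have "map (relabel (as @ ps) (map w as @ vs)) (as @ ps) = map w (as @ ps)"
        using map_relabel[OF dist(1) len] wps by simp
      then have "relabel (as @ ps) (map w as @ vs) x = w x" if "x \<in> set (as @ ps)"
        using that by (metis map_eq_conv)
      moreover have "relabel (as @ ps) (map w as @ vs) x = w x" if "x \<notin> set (as @ ps)"
        using relabel_notin[OF len that] permutes_not_in[OF wp] that unfolding dist(2) by simp
      ultimately show "relabel (as @ ps) (map w as @ vs) x = w x" by blast
    qed
    then show "(\<lambda>(us, ps). relabel (as @ ps) (us @ vs)) (map w as, map (inv w) vs) = w"
      by (simp add: ps_def)
    have co: "list_all2 (<) vs (map w as)" "list_all2 (<) (butlast as) (tl ps)"
      using c wps by (auto simp: crossout_order_iff)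
    have "map w as \<in> ?S"
      using S as c co injw by (auto simp: distinct_map inj_on_def inj_def)
    moreover have "ps \<in> ?T"
      using T T_iff[of ps] c co vs by (simp add: ps_def)
    ultimately show "(map w as, map (inv w) vs) \<in> ?S \<times> ?T"
      by (simp add: ps_def)
    have "aa n w = list_inv (map w as)"
      using as w by (intro aa_eq_list_inv) auto
    moreover have "bb n w = list_inv ps"
      using c w wps vs by (intro bb_eq_list_inv) auto
    ultimately show "(case (map w as, map (inv w) vs) of (us, ps) \<Rightarrow> q ^ list_inv us * r ^ list_inv ps)
        = q ^ aa n w * r ^ bb n w"
      by (simp add: ps_def)
  next
    fix z assume "z \<in> ?S \<times> ?T"
    then obtain us ps where z: "z = (us, ps)"
        and us: "distinct us" "set us = U" "list_all2 (<) vs us"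
        and ps: "distinct ps" "set ps = B" "list_all2 (<) (0 # butlast as) ps"
      unfolding S T by auto
    define w where "w = relabel (as @ ps) (us @ vs)"
    have len: "length us = n" "length ps = n"
      using us ps UV AB by (metis distinct_card)+
    have m: "map w (as @ ps) = us @ vs"
      unfolding w_def using as ps len vs AB by (intro map_relabel) auto
    then have mm: "map w as = us" "map w ps = vs"
      using as(3) len by simp_all
    have "w permutes set (as @ ps)"
      unfolding w_def using as ps us vs UV AB by (intro relabel_permutes) auto
    then have wp: "w permutes {1..2 * n}"
      using as ps AB by simp
    have ips: "map (inv w) vs = ps"
      using wp mm(2) by (auto simp: map_idI permutes_inverses)
    then show "(\<lambda>w. (map w as, map (inv w) vs)) ((\<lambda>(us, ps). relabel (as @ ps) (us @ vs)) z) = z"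
      using z mm by (simp add: w_def)
    have "crossout_order w as ps"
      using mm as vs us ps T_iff[of ps] len by (simp add: crossout_order_iff)
    then have "A_marks n w = A" "B_marks n w = B"
      using crossout_eq[of w as ps n] as ps AB by auto
    moreover have "w ` A = U"
      using mm(1) as us by (metis set_map)
    ultimately show "(\<lambda>(us, ps). relabel (as @ ps) (us @ vs)) z \<in> ?W"
      using z wp by (simp add: w_def)
  qed
  also have "\<dots> = (\<Sum>us\<in>?S. q ^ list_inv us) * (\<Sum>ps\<in>?T. r ^ list_inv ps)"
    by (simp add: sum_product sum.cartesian_product)
  finally show ?thesis .
qed

section \<open>Heights of Dyck paths as threshold counts\<close>

lemma not_Down: "s \<noteq> Down \<longleftrightarrow> s = Up"
  by (cases s) auto

lemma count_list_take_step_at: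
  assumes "x \<le> length p"
  shows "count_list (take x p) s = card {k \<in> {1..x}. step_at p k = s}"
  using assms
proof (induction x)
  case (Suc x)
  have "{k \<in> {1..Suc x}. step_at p k = s} =
      (if p ! x = s then insert (Suc x) {k \<in> {1..x}. step_at p k = s}
       else {k \<in> {1..x}. step_at p k = s})"
    by (auto simp: step_at_def le_Suc_eq)
  then show ?case
    using Suc by (simp add: take_Suc_conv_app_nth)
qed simp

lemma length_filter_sorted_list_of_set:
  assumes "finite X"
  shows "length (filter P (sorted_list_of_set X)) = card {x \<in> X. P x}"
  using assms by (metis distinct_card distinct_filter distinct_sorted_list_of_set set_filter
      set_sorted_list_of_set)

text \<open>Brings heights into the form of the counts in \<open>sum_arrangements_above\<close>. The
  range reaches \<open>length p + 1\<close> so that the endpoint of the path is included.\<close>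

lemma height_at_eq:
  assumes "1 \<le> x" "x \<le> length p + 1"
  shows "height_at p (x - 1) =
    int (length (filter (\<lambda>y. y < x) (sorted_list_of_set ({1..length p} - down_positions p)))) -
    int (length (filter (\<lambda>y. y < x) (sorted_list_of_set (down_positions p))))"
proof -
  have "{k \<in> {1..x - 1}. step_at p k = Down} = {y \<in> down_positions p. y < x}"
    "{k \<in> {1..x - 1}. step_at p k = Up} = {y \<in> {1..length p} - down_positions p. y < x}"
    using assms by (auto simp: down_positions_def not_Down)
  then show ?thesis
    using assms unfolding height_at_def
    by (simp add: count_list_take_step_at length_filter_sorted_list_of_set down_positions_def)
qed

lemma finite_down_positions: "finite (down_positions p)"
  by (simp add: down_positions_def)

lemma card_down_positions:
  assumes "dyck_path N p"
  shows "card (down_positions p) = N" "card ({1..2 * N} - down_positions p) = N"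
proof -
  have len: "length p = 2 * N" and h: "height_at p (2 * N) = 0"
    using assms by (auto simp: dyck_path_def)
  have sub: "down_positions p \<subseteq> {1..2 * N}"
    using len by (auto simp: down_positions_def)
  have "{y \<in> {1..2 * N} - down_positions p. y < 2 * N + 1} = {1..2 * N} - down_positions p"
    "{y \<in> down_positions p. y < 2 * N + 1} = down_positions p"
    using sub by auto
  then have "card ({1..2 * N} - down_positions p) = card (down_positions p)"
    using height_at_eq[of "2 * N + 1" p] h len finite_down_positions
    by (simp add: length_filter_sorted_list_of_set)
  moreover have "card ({1..2 * N} - down_positions p) + card (down_positions p) = 2 * N"
    using sub card_Diff_subset[OF finite_down_positions sub] card_mono[OF _ sub] by simp
  ultimately show "card (down_positions p) = N" "card ({1..2 * N} - down_positions p) = N"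
    by simp_all
qed

lemma path_of_downs_eq_iff:
  assumes "length p = 2 * N" "D \<subseteq> {1..2 * N}"
  shows "path_of_downs N D = p \<longleftrightarrow> D = down_positions p"
proof
  assume "path_of_downs N D = p"
  then have "step_at p k = (if k \<in> D then Down else Up)" if "k \<in> {1..2 * N}" for k
    using that by (auto simp: step_at_def path_of_downs_def simp del: upt_Suc)
  then show "D = down_positions p"
    using assms by (auto simp: down_positions_def split: if_splits)
next
  assume D: "D = down_positions p"
  show "path_of_downs N D = p"
  proof (rule nth_equalityI)
    show "length (path_of_downs N D) = length p"
      using assms by (simp add: path_of_downs_def)
    fix i assume "i < length (path_of_downs N D)"
    then have i: "i < 2 * N" by (simp add: path_of_downs_def del: upt_Suc)
    then have "Suc i \<in> D \<longleftrightarrow> p ! i = Down"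
      using assms by (simp add: D down_positions_def step_at_def)
    then show "path_of_downs N D ! i = p ! i"
      using i by (cases "p ! i") (simp_all add: path_of_downs_def del: upt_Suc)
  qed
qed

lemma length_filter_less_nth:
  assumes "sorted_wrt (<) (xs::nat list)" "i < length xs"
  shows "length (filter (\<lambda>y. y < xs ! i) xs) = i"
proof -
  let ?l = "length (filter (\<lambda>y. y < xs ! i) xs)"
  have *: "xs ! j < xs ! i \<longleftrightarrow> j < ?l" if "j < length xs" for j
    using assms that by (intro length_filter_less_sorted) (auto simp: strict_sorted_iff)
  have "\<not> i < ?l"
    using *[of i] assms by simp
  moreover have "\<not> ?l < i"
    using *[of ?l] assms(2) sorted_wrt_nth_less[OF assms(1), of ?l i] by linarith
  ultimately show ?thesis by simp
qed

text \<open>Exactly \<open>i\<close> down steps precede the one with zero-based index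
  \<open>i\<close>. The height is thus the bracket size of \<open>sum_arrangements_above\<close>
  with the up positions as thresholds.\<close>

lemma down_height_eq:
  assumes "length p = 2 * N" "i < card (down_positions p)"
  shows "down_height p (Suc i) =
    length (filter (\<lambda>y. y < sorted_list_of_set (down_positions p) ! i)
      (sorted_list_of_set ({1..2 * N} - down_positions p))) - i"
proof -
  let ?xs = "sorted_list_of_set (down_positions p)"
  have i: "i < length ?xs"
    using assms by simp
  then have "?xs ! i \<in> down_positions p"
    using nth_mem[OF i] finite_down_positions by simp
  then have "1 \<le> ?xs ! i" "?xs ! i \<le> length p + 1"
    by (auto simp: down_positions_def)
  from height_at_eq[OF this] show ?thesis
    using length_filter_less_nth[of ?xs i] i assms
    by (simp add: down_height_def down_pos_def)
qed

text \<open>Negative heights at 1 and at \<open>2 * n + 1\<close> are excluded. The two forced steps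
  are what the shift by one and the extra position \<open>2 * n + 2\<close> in \<open>p_B\<close>
  account for.\<close>

lemma dyck_path_first_last:
  assumes "dyck_path (n + 1) p"
  shows "1 \<notin> down_positions p" "2 * n + 2 \<in> down_positions p"
proof -
  have len: "length p = 2 * n + 2" and nonneg: "\<And>x. x \<le> 2 * n + 2 \<Longrightarrow> 0 \<le> height_at p x"
    and fin: "height_at p (2 * n + 2) = 0"
    using assms by (auto simp: dyck_path_def)
  have "take 1 p = [p ! 0]"
    using len by (cases p) auto
  then show "1 \<notin> down_positions p"
    using nonneg[of 1] by (auto simp: height_at_def down_positions_def step_at_def split: if_splits)
  have "take (2 * n + 2) p = take (2 * n + 1) p @ [p ! (2 * n + 1)]"
    using len take_Suc_conv_app_nth[of "2 * n + 1" p] by simp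
  then have "p ! (2 * n + 1) \<noteq> Up"
    using nonneg[of "2 * n + 1"] fin by (auto simp: height_at_def)
  then show "2 * n + 2 \<in> down_positions p"
    using len by (cases "p ! (2 * n + 1)") (auto simp: down_positions_def step_at_def)
qed

text \<open>Dropping the largest entry changes the count exactly when it lies below
  \<open>b\<close>, that is, when no entry exceeds \<open>b\<close>. This is the case distinction of
  the starred height.\<close>

lemma length_filter_butlast:
  assumes "xs \<noteq> []" "sorted (xs::nat list)" "b \<notin> set xs"
  shows "length (filter (\<lambda>y. y < b) (butlast xs)) =
    (if \<exists>x\<in>set xs. b < x then length (filter (\<lambda>y. y < b) xs)
     else length (filter (\<lambda>y. y < b) xs) - 1)"
proof -
  have xs: "xs = butlast xs @ [last xs]"
    using assms(1) by simp
  have "x \<le> last xs" if "x \<in> set xs" for x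
    using that assms(2) xs by (metis Un_iff empty_iff empty_set insert_iff list.simps(15) order_refl
        set_append sorted_append)
  then have "(\<exists>x\<in>set xs. b < x) \<longleftrightarrow> b < last xs"
    using assms(1) by (meson last_in_set less_le_trans)
  moreover have "b \<noteq> last xs"
    using assms(1,3) last_in_set by metis
  moreover have "length (filter (\<lambda>y. y < b) xs) =
      length (filter (\<lambda>y. y < b) (butlast xs)) + (if last xs < b then 1 else 0)"
    by (subst xs) simp
  ultimately show ?thesis by auto
qed

text \<open>Shifted back by one, the up positions of \<open>\<beta>\<close> are 0 and the A
  positions. Omitting the last A position costs one exactly when no up step lies to the right, which
  is what the star records.\<close>

lemma down_height_star_eq:
  assumes n: "n \<ge> 1" and dyck: "dyck_path (n + 1) \<beta>"
    and AB: "A \<union> B = {1..2 * n}" "A \<inter> B = {}" "card A = n"  "card B = n"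
    and down: "down_positions \<beta> = Suc ` B \<union> {2 * n + 2}"
    and i: "i < n"
  shows "down_height_star \<beta> (Suc i) =
    length (filter (\<lambda>t. t < sorted_list_of_set B ! i) (0 # butlast (sorted_list_of_set A))) - i"
proof -
  have fin: "finite A" "finite B"
    using AB(1) by (metis finite_Un finite_atLeastAtMost)+
  have len: "length \<beta> = 2 * (n + 1)"
    using dyck by (simp add: dyck_path_def)
  define as bs where "as = sorted_list_of_set A" and "bs = sorted_list_of_set B"
  have as: "set as = A" "sorted_wrt (<) as" "length as = n"
    and bs: "set bs = B" "sorted_wrt (<) bs" "length bs = n"
    using fin AB by (auto simp: as_def bs_def)
  define b where "b = bs ! i"
  have b: "b \<in> B" "1 \<le> b"
    using i bs AB nth_mem[of i bs] by (auto simp: b_def)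
  have B_le: "x \<le> 2 * n" if "x \<in> B" for x
    using that AB(1) by auto
  have downs: "sorted_list_of_set (down_positions \<beta>) = map Suc bs @ [2 * n + 2]"
  proof -
    have "sorted_wrt (<) (map Suc bs @ [2 * n + 2])"
      using bs(1,2) B_le by (auto simp: sorted_wrt_append sorted_wrt_map le_imp_less_Suc)
    moreover have "set (map Suc bs @ [2 * n + 2]) = down_positions \<beta>"
      using bs by (simp add: down)
    ultimately show ?thesis
      using strict_sorted_list_unique by metis
  qed
  have ups_set: "{1..2 * (n + 1)} - down_positions \<beta> = insert 1 (Suc ` A)"
  proof -
    have "{1..2 * (n + 1)} = insert 1 (Suc ` (A \<union> B)) \<union> {2 * n + 2}"
      unfolding AB(1) by (auto simp: image_Suc_atLeastAtMost)
    moreover have "0 \<notin> A \<union> B" "2 * n + 1 \<notin> A \<union> B"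
      using AB(1) by auto
    ultimately show ?thesis
      using AB(2) by (auto simp: down)
  qed
  have "A \<subseteq> {1..2 * n}"
    using AB(1) by blast
  then have A_pos: "0 < x" if "x \<in> A" for x
    using that by auto
  have ups: "sorted_list_of_set ({1..2 * (n + 1)} - down_positions \<beta>) = 1 # map Suc as"
  proof -
    have "sorted_wrt (<) (1 # map Suc as)"
      using as(1,2) A_pos by (auto simp: sorted_wrt_map)
    moreover have "set (1 # map Suc as) = {1..2 * (n + 1)} - down_positions \<beta>"
      unfolding ups_set using as by simp
    ultimately show ?thesis
      using strict_sorted_list_unique by metis
  qed
  have nth: "sorted_list_of_set (down_positions \<beta>) ! i = Suc b"
    using i bs by (simp add: downs b_def nth_append)
  have "card (down_positions \<beta>) = n + 1"
    using card_down_positions[OF dyck] by simp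
  then have height: "down_height \<beta> (Suc i) = Suc (length (filter (\<lambda>y. y < b) as)) - i"
    using down_height_eq[OF len, of i] i b unfolding ups nth by (simp add: filter_map comp_def)
  have "(\<exists>k\<in>{1..length \<beta>}. Suc b < k \<and> step_at \<beta> k = Up) \<longleftrightarrow>
      (\<exists>k\<in>{1..2 * (n + 1)} - down_positions \<beta>. Suc b < k)"
    using len by (auto simp: down_positions_def not_Down)
  also have "\<dots> \<longleftrightarrow> (\<exists>a\<in>set as. b < a)"
    unfolding ups_set by (simp add: as)
  finally have star: "down_height_star \<beta> (Suc i) =
      (if \<exists>a\<in>set as. b < a then down_height \<beta> (Suc i) else down_height \<beta> (Suc i) - 1)"
    using nth by (simp add: down_height_star_def down_pos_def)
  \<comment> \<open>If no A position exceeds \<open>b\<close>, all \<open>n \<ge> 1\<close> of them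
    lie below it, so subtracting one from their number does not truncate.\<close>
  have all: "filter (\<lambda>y. y < b) as = as" if "\<not> (\<exists>a\<in>set as. b < a)"
    using that b as(1) AB(2) by (auto simp: filter_id_conv not_less le_less)
  have "length (filter (\<lambda>y. y < b) (butlast as)) =
    (if \<exists>x\<in>set as. b < x then length (filter (\<lambda>y. y < b) as)
     else length (filter (\<lambda>y. y < b) as) - 1)"
    using as n b AB(2) by (intro length_filter_butlast) (auto simp: strict_sorted_iff)
  then have "length (filter (\<lambda>t. t < b) (0 # butlast as)) - i = down_height_star \<beta> (Suc i)"
    using b i n all as(3) by (auto simp: star height)
  then show ?thesis
    by (simp only: as_def bs_def b_def)
qed

section \<open>Assembling the product formula\<close>

theorem theorem2:
  fixes n :: nat and \<alpha> \<beta> :: path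
  assumes "n \<ge> 1"
    and "dyck_path n \<alpha>"
    and "dyck_path (n + 1) \<beta>"
  shows "(\<Sum>w\<in>perms_with_paths n \<alpha> \<beta>. var_q ^ aa n w * var_r ^ bb n w) =
         (\<Prod>i=1..n. q_bracket var_q (down_height \<alpha> i) * q_bracket var_r (down_height_star \<beta> i))"
proof -
  define U where "U = down_positions \<alpha>"
  define V where "V = {1..2 * n} - U"
  \<comment> \<open>\<open>B\<close> undoes the shift in \<open>p_B\<close> and drops the final down
    step.\<close>
  define B where "B = {b. Suc b \<in> down_positions \<beta> - {2 * n + 2}}"
  define A where "A = {1..2 * n} - B"
  have len: "length \<alpha> = 2 * n" "length \<beta> = 2 * (n + 1)"
    using assms by (auto simp: dyck_path_def)
  have U_sub: "U \<subseteq> {1..2 * n}"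
    using len by (auto simp: U_def down_positions_def)
  have UV: "U \<union> V = {1..2 * n}" "U \<inter> V = {}" "card U = n" "card V = n"
    using U_sub card_down_positions[OF assms(2)] by (auto simp: U_def V_def)
  have down: "down_positions \<beta> = Suc ` B \<union> {2 * n + 2}"
  proof -
    have "k \<in> Suc ` B" if "k \<in> down_positions \<beta>" "k \<noteq> 2 * n + 2" for k
      using that by (cases k) (auto simp: B_def down_positions_def)
    then show ?thesis
      using dyck_path_first_last[OF assms(3)] by (auto simp: B_def)
  qed
  have B_sub: "B \<subseteq> {1..2 * n}"
  proof
    fix b assume b: "b \<in> B"
    then have "b \<noteq> 0"
      using dyck_path_first_last(1)[OF assms(3)] by (auto simp: B_def intro!: gr0I)
    then show "b \<in> {1..2 * n}"
      using b len by (auto simp: B_def down_positions_def)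
  qed
  then have finB: "finite B"
    by (rule finite_subset) simp
  have "card (Suc ` B \<union> {2 * n + 2}) = Suc (card B)"
    using finB by (subst card_Un_disjoint) (auto simp: B_def card_image)
  then have cB: "card B = n"
    using card_down_positions(1)[OF assms(3)] down by simp
  have AB: "A \<union> B = {1..2 * n}" "A \<inter> B = {}" "card A = n" "card B = n"
    using B_sub cB card_Diff_subset[OF finB B_sub] by (auto simp: A_def)
  \<comment> \<open>The path \<open>\<beta>\<close> fixes the B marks and with them the A marks;
    then \<open>\<alpha>\<close> fixes the set of A values.\<close>
  have W: "perms_with_paths n \<alpha> \<beta> =
      {w. w permutes {1..2 * n} \<and> A_marks n w = A \<and> B_marks n w = B \<and> w ` A = U}"
  proof -
    have "p_A n w = \<alpha> \<and> p_B n w = \<beta> \<longleftrightarrow> A_marks n w = A \<and> B_marks n w = B \<and> w ` A = U"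
      if wp: "w permutes {1..2 * n}" for w
    proof -
      obtain as ps where o: "crossout_order w as ps" "set as \<union> set ps = {1..2 * n}"
          "length as = n" "length ps = n"
        using crossout_order_exists[of "{1..2 * n}" n w] permutes_inj[OF wp]
        by (auto intro: inj_on_subset)
      note marks = crossout_eq[OF o(1,2)]
      \<comment> \<open>Two lists of length \<open>n\<close> cover \<open>2 * n\<close> positions,
        so they cannot overlap and the A marks are the complement of the B marks.\<close>
      have "card (set as) + card (set ps) \<le> card (set as \<union> set ps)"
        unfolding o(2) using o(3,4) card_length[of as] card_length[of ps] by simp
      then have "set as \<inter> set ps = {}"
        using card_Un_Int[of "set as" "set ps"] by (simp add: card_eq_0_iff)
      then have A: "A_marks n w = A" if "B_marks n w = B"
        using that marks o(2) by (auto simp: A_def)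
      have "w ` A_marks n w \<subseteq> {1..2 * n}"
        using marks o(2) permutes_image[OF wp] by blast
      then have pA: "p_A n w = \<alpha> \<longleftrightarrow> w ` A_marks n w = U"
        unfolding p_A_def U_def using len by (intro path_of_downs_eq_iff)
      have B_mem: "B_marks n w \<subseteq> {1..2 * n}"
        using marks o(2) by auto
      then have "p_B n w = \<beta> \<longleftrightarrow> Suc ` B_marks n w \<union> {2 * n + 2} = down_positions \<beta>"
        unfolding p_B_def Suc_eq_plus1[symmetric] using len by (intro path_of_downs_eq_iff) auto
      also have "\<dots> \<longleftrightarrow> Suc ` B_marks n w = Suc ` B"
      proof -
        have "2 * n + 2 \<notin> Suc ` B_marks n w" "2 * n + 2 \<notin> Suc ` B"
          using B_mem B_sub by auto
        then show ?thesis unfolding down by (simp add: insert_ident)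
      qed
      also have "\<dots> \<longleftrightarrow> B_marks n w = B"
        by (simp add: inj_image_eq_iff)
      finally show ?thesis
        using pA A by auto
    qed
    then show ?thesis
      unfolding perms_with_paths_def by (intro Collect_cong) blast
  qed
  define as bs us vs where "as = sorted_list_of_set A" and "bs = sorted_list_of_set B"
    and "us = sorted_list_of_set U" and "vs = sorted_list_of_set V"
  have lens: "length as = n" "length bs = n" "length us = n" "length vs = n"
    using AB UV by (auto simp: as_def bs_def us_def vs_def)
  have "sorted (butlast as)"
    unfolding as_def by (simp add: sorted_butlast)
  then have sorted: "sorted (0 # butlast as)" "sorted vs" "sorted_wrt (<) us" "sorted_wrt (<) bs"
    by (auto simp: bs_def us_def vs_def)
  have "(\<Sum>w\<in>perms_with_paths n \<alpha> \<beta>. var_q ^ aa n w * var_r ^ bb n w) =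
      (\<Sum>xs\<in>arrangements_above vs us. var_q ^ list_inv xs) *
      (\<Sum>ps\<in>arrangements_above (0 # butlast as) bs. var_r ^ list_inv ps)"
    unfolding W as_def bs_def us_def vs_def using assms(1) AB UV by (rule sum_crossout_factorizes)
  also have "\<dots> =
      (\<Prod>i<n. q_bracket var_q (length (filter (\<lambda>t. t < us ! i) vs) - i)) *
      (\<Prod>i<n. q_bracket var_r (length (filter (\<lambda>t. t < bs ! i) (0 # butlast as)) - i))"
    using sorted lens assms(1)
    by (subst (1 2) sum_arrangements_above) simp_all
  \<comment> \<open>The entries \<open>us\<close> are the down positions of \<open>\<alpha>\<close>
    and the thresholds \<open>vs\<close> its up positions, so the first factors are its
    heights.\<close>
  also have "\<dots> = (\<Prod>i<n. q_bracket var_q (down_height \<alpha> (Suc i)) *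
      q_bracket var_r (down_height_star \<beta> (Suc i)))"
    unfolding prod.distrib[symmetric]
    using down_height_eq[OF len(1)] UV(3) down_height_star_eq[OF assms(1,3) AB down]
    by (intro prod.cong) (auto simp: U_def V_def as_def bs_def us_def vs_def)
  also have "\<dots> = (\<Prod>i=1..n. q_bracket var_q (down_height \<alpha> i) * q_bracket var_r (down_height_star \<beta> i))"
    by (rule prod.reindex_bij_witness[where i = "\<lambda>i. i - 1" and j = Suc]) auto
  finally show ?thesis .
qed

end
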